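(* There exist well-conditioned probability distributions for which any non-orthogonal linear preconditioner will cause the condition number to increase; that is, there exist a dimension $d$ and a well-conditioned distribution $\Pi$ on $\mathbb{R}^d$ with condition number $\kappa$ such that, for every non-orthogonal $L\in GL_d(\mathbb{R})$, the condition number $\tilde\kappa$ after preconditioning with $L$ satisfies $\tilde\kappa>\kappa$.
   Context: A probability measure $\Pi$ on $\mathbb{R}^d$ with Lebesgue density $\pi(x)\propto\exp(-U(x))$ is called well-conditioned if $U\in C^2(\mathbb{R}^d)$ and there are constants $M\ge m>0$ with $m\mathbf{I}_d\preceq\nabla^2U(x)\preceq M\mathbf{I}_d$ for all $x\in\mathbb{R}^d$. Its condition number is $\kappa=M/m$, equivalently $\kappa=\sup_{x}\|\nabla^2U(x)\|\,\sup_{x}\|\nabla^2U(x)^{-1}\|$ (operator 2-norm). Linear preconditioning with $L\in GL_d(\mathbb{R})$ means replacing $\Pi$ by the law of $LX$, $X\sim\Pi$; the condition number after preconditioning is $\tilde\kappa=\sup_{x}\|L^{-T}\nabla^2U(x)L^{-1}\|\,\sup_{x}\|L\nabla^2U(x)^{-1}L^{T}\|$.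
   Formalization: "Non-orthogonal L" is read as "no scalar multiple of L is orthogonal", since for L = cQ with Q orthogonal and c nonzero (e.g. L = 2I) the condition number is unchanged and the strict inequality fails; the dimension is also required to be at least 2, so the claim is not vacuous. *)

theory Defs
  imports "HOL-Probability.Probability" "Jordan_Normal_Form.Gauss_Jordan_Elimination"
begin

text \<open>
  The dimension \<open>d\<close> is quantified inside the theorem, so points of \<open>\<real>\<^sup>d\<close> are the extensional
  functions on \<open>{..<d}\<close>. These form the space of \<open>\<Pi>\<^sub>M i\<in>{..<d}. lborel\<close>, which is Lebesgue measure on
  \<open>\<real>\<^sup>d\<close>, and the product topology on \<^typ>\<open>nat \<Rightarrow> real\<close> restricts to the Euclidean one. Matrices are
  those of \<^theory>\<open>Jordan_Normal_Form.Matrix\<close>.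
\<close>

definition Rn :: "nat \<Rightarrow> (nat \<Rightarrow> real) set" where
  "Rn d = (\<Pi>\<^sub>E i\<in>{..<d}. UNIV)"

definition lborel_Rn :: "nat \<Rightarrow> (nat \<Rightarrow> real) measure" where
  "lborel_Rn d = (\<Pi>\<^sub>M i\<in>{..<d}. lborel)"

definition partial :: "nat \<Rightarrow> ((nat \<Rightarrow> real) \<Rightarrow> real) \<Rightarrow> (nat \<Rightarrow> real) \<Rightarrow> real" where
  "partial i f x = deriv (\<lambda>t. f (x(i := t))) (x i)"

definition has_partials :: "nat \<Rightarrow> ((nat \<Rightarrow> real) \<Rightarrow> real) \<Rightarrow> bool" where
  "has_partials d f \<longleftrightarrow>
     (\<forall>i<d. \<forall>x\<in>Rn d. (\<lambda>t. f (x(i := t))) field_differentiable (at (x i)))"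

definition C2 :: "nat \<Rightarrow> ((nat \<Rightarrow> real) \<Rightarrow> real) \<Rightarrow> bool" where
  "C2 d f \<longleftrightarrow>
     continuous_on (Rn d) f \<and> has_partials d f \<and>
     (\<forall>i<d. continuous_on (Rn d) (partial i f) \<and> has_partials d (partial i f) \<and>
        (\<forall>j<d. continuous_on (Rn d) (partial j (partial i f))))"

definition hessian :: "nat \<Rightarrow> ((nat \<Rightarrow> real) \<Rightarrow> real) \<Rightarrow> (nat \<Rightarrow> real) \<Rightarrow> real mat" where
  "hessian d f x = mat d d (\<lambda>(i, j). partial i (partial j f) x)"

definition vnorm :: "real Matrix.vec \<Rightarrow> real" where
  "vnorm v = sqrt (v \<bullet> v)"

definition opnorm :: "real mat \<Rightarrow> real" where
  "opnorm A = (SUP v\<in>{v \<in> carrier_vec (dim_col A). vnorm v \<le> 1}. vnorm (A *\<^sub>v v))"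

text \<open>Only meaningful for invertible matrices, which is all it is applied to below.\<close>

definition minv :: "real mat \<Rightarrow> real mat" where
  "minv A = the (mat_inverse A)"

definition loewner_le :: "nat \<Rightarrow> real mat \<Rightarrow> real mat \<Rightarrow> bool" where
  "loewner_le d A B \<longleftrightarrow> (\<forall>v\<in>carrier_vec d. v \<bullet> (A *\<^sub>v v) \<le> v \<bullet> (B *\<^sub>v v))"

definition GL :: "nat \<Rightarrow> real mat set" where
  "GL d = {L \<in> carrier_mat d d. invertible_mat L}"

text \<open>The library's \<^const>\<open>orthogonal_mat\<close> does not require the columns to be normalised.\<close>

definition orthogonal_matrices :: "nat \<Rightarrow> real mat set" where
  "orthogonal_matrices d = {Q \<in> carrier_mat d d. Q\<^sup>T * Q = 1\<^sub>m d}"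

text \<open>\<open>\<mu>\<close> is a well-conditioned probability measure on \<open>\<real>\<^sup>d\<close> with potential \<open>U\<close>; the potential is
  determined by \<open>\<mu>\<close> up to an additive constant, which does not affect the Hessian.\<close>

definition well_conditioned ::
  "nat \<Rightarrow> (nat \<Rightarrow> real) measure \<Rightarrow> ((nat \<Rightarrow> real) \<Rightarrow> real) \<Rightarrow> bool" where
  "well_conditioned d \<mu> U \<longleftrightarrow>
     prob_space \<mu> \<and>
     (\<exists>c>0. \<mu> = density (lborel_Rn d) (\<lambda>x. ennreal (c * exp (- U x)))) \<and>
     C2 d U \<and>
     (\<exists>m M. 0 < m \<and> m \<le> M \<and>
        (\<forall>x\<in>Rn d. loewner_le d (m \<cdot>\<^sub>m 1\<^sub>m d) (hessian d U x) \<and>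
                   loewner_le d (hessian d U x) (M \<cdot>\<^sub>m 1\<^sub>m d)))"

text \<open>For a well-conditioned potential and \<open>L \<in> GL d\<close> the suprema below are over bounded sets. In
  dimension \<open>d \<ge> 1\<close>, \<open>cond_number d U\<close> is \<open>M / m\<close> for the optimal constants \<open>m\<close> and \<open>M\<close>.\<close>

definition cond_number :: "nat \<Rightarrow> ((nat \<Rightarrow> real) \<Rightarrow> real) \<Rightarrow> real" where
  "cond_number d U =
     (SUP x\<in>Rn d. opnorm (hessian d U x)) * (SUP x\<in>Rn d. opnorm (minv (hessian d U x)))"

definition precond_cond_number ::
  "nat \<Rightarrow> real mat \<Rightarrow> ((nat \<Rightarrow> real) \<Rightarrow> real) \<Rightarrow> real" where
  "precond_cond_number d L U =
     (SUP x\<in>Rn d. opnorm ((minv L)\<^sup>T * hessian d U x * minv L)) *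
     (SUP x\<in>Rn d. opnorm (L * minv (hessian d U x) * L\<^sup>T))"

text \<open>Replacing \<open>L\<close> by \<open>c \<cdot>\<^sub>m L\<close> with \<open>c \<noteq> 0\<close> does not change \<open>precond_cond_number d L U\<close>. A strict
  increase is therefore possible only if no scalar multiple of \<open>L\<close> is orthogonal, and in dimension
  \<open>1\<close> there is no such \<open>L\<close>.\<close>

end

theory Submission imports Defs begin

text \<open>
  Take the product potential \<open>U x = (\<Sum>i<d. g (x i))\<close> with \<open>g t = t\<^sup>2 - cos t\<close>. Its Hessian is the
  diagonal matrix with entries \<open>2 + cos (x i)\<close>, which lies between \<open>1\<close> and \<open>3\<close> and attains both
  \<open>1\<^sub>m d\<close> and \<open>3 \<cdot>\<^sub>m 1\<^sub>m d\<close>, so \<open>\<kappa> \<le> 3\<close>. Evaluating the two suprema of \<open>\<kappa>'\<close> (the condition number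
  after preconditioning) at these two points gives \<open>\<kappa>' \<ge> 3 a b\<close>, where \<open>a\<close> and \<open>b\<close> are the norms of
  \<open>L\<^sup>-\<^sup>T L\<^sup>-\<^sup>1\<close> and \<open>L L\<^sup>T\<close>. For all \<open>v\<close> one has \<open>\<bar>v\<bar>\<^sup>2 \<le> a \<bar>L v\<bar>\<^sup>2\<close> and \<open>\<bar>L v\<bar>\<^sup>2 \<le> b \<bar>v\<bar>\<^sup>2\<close>; hence
  \<open>a b \<le> 1\<close> forces \<open>a \<bar>L v\<bar>\<^sup>2 = \<bar>v\<bar>\<^sup>2\<close> for all \<open>v\<close>, and \<open>sqrt a L\<close> is orthogonal by polarization.
\<close>

section \<open>Euclidean and operator norms\<close>

lemma scalar_prod_self_nonneg: "0 \<le> v \<bullet> (v :: real Matrix.vec)"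
  by (auto simp: scalar_prod_def intro: sum_nonneg)

lemma vnorm_nonneg: "0 \<le> vnorm v"
  by (simp add: vnorm_def scalar_prod_self_nonneg)

lemma vnorm_power2: "(vnorm v)\<^sup>2 = v \<bullet> v"
  by (simp add: vnorm_def scalar_prod_self_nonneg)

lemma vnorm_smult: "vnorm (c \<cdot>\<^sub>v v) = \<bar>c\<bar> * vnorm v"
  by (simp add: vnorm_def real_sqrt_mult flip: mult.assoc power2_eq_square)

lemma vnorm_zero: "vnorm (0\<^sub>v n) = 0"
  by (simp add: vnorm_def scalar_prod_def)

lemma vnorm_eq_0_imp:
  assumes "vnorm v = 0" "v \<in> carrier_vec n"
  shows "v = 0\<^sub>v n"
proof -
  have "(\<Sum>i<dim_vec v. (Matrix.vec_index v i)\<^sup>2) = 0"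
    using assms(1) by (simp add: vnorm_def scalar_prod_def power2_eq_square atLeast0LessThan)
  then have "Matrix.vec_index v i = 0" if "i < n" for i
    using that assms(2) by (subst (asm) sum_nonneg_eq_0_iff) auto
  then show ?thesis
    using assms(2) by (intro eq_vecI) auto
qed

lemma scalar_prod_le_vnorm:
  assumes "v \<in> carrier_vec n" "w \<in> carrier_vec n"
  shows "v \<bullet> w \<le> vnorm v * vnorm w"
proof -
  have "(v \<bullet> w)\<^sup>2 \<le> (v \<bullet> v) * (w \<bullet> w)"
    using Cauchy_Schwarz_ineq_sum[of "Matrix.vec_index v" "Matrix.vec_index w" "{0..<n}"] assms
    by (simp add: scalar_prod_def power2_eq_square)
  then have "(v \<bullet> w)\<^sup>2 \<le> (vnorm v * vnorm w)\<^sup>2"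
    by (simp add: power_mult_distrib vnorm_power2)
  then show ?thesis
    by (rule power2_le_imp_le) (simp add: vnorm_nonneg)
qed

text \<open>Cauchy-Schwarz applied to each row gives the Frobenius norm as a constant. Any finite
  constant will do: it makes the supremum in \<open>opnorm\<close> one over a bounded set, so that
  \<open>cSUP_upper\<close> applies to it.\<close>

lemma vnorm_mult_mat_vec_bounded:
  fixes A :: "real mat"
  assumes A: "A \<in> carrier_mat m n"
  obtains K where "0 \<le> K" "\<And>v. v \<in> carrier_vec n \<Longrightarrow> vnorm (A *\<^sub>v v) \<le> K * vnorm v"
proof
  define S where "S = (\<Sum>i<m. row A i \<bullet> row A i)"
  show "0 \<le> sqrt S"
    by (simp add: S_def sum_nonneg scalar_prod_self_nonneg)
  fix v :: "real Matrix.vec" assume v: "v \<in> carrier_vec n"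
  have "(A *\<^sub>v v) \<bullet> (A *\<^sub>v v) = (\<Sum>i<m. (row A i \<bullet> v)\<^sup>2)"
    using A by (simp add: scalar_prod_def[of "A *\<^sub>v v"] power2_eq_square atLeast0LessThan)
  also have "\<dots> \<le> (\<Sum>i<m. (row A i \<bullet> row A i) * (v \<bullet> v))"
  proof (rule sum_mono)
    fix i assume "i \<in> {..<m}"
    show "(row A i \<bullet> v)\<^sup>2 \<le> (row A i \<bullet> row A i) * (v \<bullet> v)"
      using Cauchy_Schwarz_ineq_sum[of "Matrix.vec_index (row A i)" "Matrix.vec_index v" "{0..<n}"] A v
      by (simp add: scalar_prod_def power2_eq_square)
  qed
  finally have "(A *\<^sub>v v) \<bullet> (A *\<^sub>v v) \<le> S * (v \<bullet> v)"
    by (simp add: S_def sum_distrib_right)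
  then show "vnorm (A *\<^sub>v v) \<le> sqrt S * vnorm v"
    by (simp add: vnorm_def flip: real_sqrt_mult)
qed

lemma opnorm_bdd_above:
  "bdd_above ((\<lambda>v. vnorm (A *\<^sub>v v)) ` {v \<in> carrier_vec (dim_col A). vnorm v \<le> 1})"
proof -
  have A: "A \<in> carrier_mat (dim_row A) (dim_col A)"
    by simp
  obtain K where K: "0 \<le> K" "\<And>v. v \<in> carrier_vec (dim_col A) \<Longrightarrow> vnorm (A *\<^sub>v v) \<le> K * vnorm v"
    using vnorm_mult_mat_vec_bounded[OF A] by blast
  have "vnorm (A *\<^sub>v v) \<le> K" if "v \<in> carrier_vec (dim_col A)" "vnorm v \<le> 1" for v
    using K(2)[OF that(1)] mult_left_mono[OF that(2) K(1)] by simp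
  then show ?thesis
    by (intro bdd_aboveI2[where M = K]) auto
qed

lemma opnorm_nonneg: "0 \<le> opnorm A"
  unfolding opnorm_def
  by (rule cSUP_upper2[OF opnorm_bdd_above, of "0\<^sub>v (dim_col A)"])
     (auto simp: vnorm_nonneg vnorm_zero)

lemma vnorm_mult_mat_vec_le:
  fixes A :: "real mat"
  assumes A: "A \<in> carrier_mat m n" and v: "v \<in> carrier_vec n"
  shows "vnorm (A *\<^sub>v v) \<le> opnorm A * vnorm v"
proof (cases "vnorm v = 0")
  case True
  have "A *\<^sub>v 0\<^sub>v n = 0\<^sub>v m"
    using A by auto
  then show ?thesis
    using True vnorm_eq_0_imp[OF True v] by (simp add: vnorm_zero)
next
  case False
  \<comment> \<open>Scaling \<open>v\<close> to unit length makes it an admissible vector in the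
    supremum defining \<open>opnorm A\<close>.\<close>
  define c where "c = 1 / vnorm v"
  have pos: "vnorm v > 0"
    using False vnorm_nonneg[of v] by simp
  have "vnorm (A *\<^sub>v (c \<cdot>\<^sub>v v)) \<le> opnorm A"
    unfolding opnorm_def using A v pos
    by (intro cSUP_upper[OF _ opnorm_bdd_above]) (auto simp: vnorm_smult c_def)
  then have "c * vnorm (A *\<^sub>v v) \<le> opnorm A"
    using A v pos by (simp add: mult_mat_vec vnorm_smult c_def)
  then show ?thesis
    using pos by (simp add: c_def field_simps)
qed

lemma opnorm_le:
  assumes A: "A \<in> carrier_mat m n" and "0 \<le> K"
    and K: "\<And>v. v \<in> carrier_vec n \<Longrightarrow> vnorm (A *\<^sub>v v) \<le> K * vnorm v"
  shows "opnorm A \<le> K"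
  unfolding opnorm_def
proof (rule cSUP_least)
  show "{v \<in> carrier_vec (dim_col A). vnorm v \<le> 1} \<noteq> {}"
    by (auto simp: vnorm_zero intro!: exI[of _ "0\<^sub>v (dim_col A)"])
  fix v assume "v \<in> {v \<in> carrier_vec (dim_col A). vnorm v \<le> 1}"
  then have v: "v \<in> carrier_vec n" "vnorm v \<le> 1"
    using A by auto
  show "vnorm (A *\<^sub>v v) \<le> K"
    using K[OF v(1)] mult_left_mono[OF v(2) \<open>0 \<le> K\<close>] by simp
qed

lemma opnorm_mult_le:
  fixes A B :: "real mat"
  assumes A: "A \<in> carrier_mat m k" and B: "B \<in> carrier_mat k n"
  shows "opnorm (A * B) \<le> opnorm A * opnorm B"
proof (rule opnorm_le)
  show "A * B \<in> carrier_mat m n"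
    using A B by simp
  show "0 \<le> opnorm A * opnorm B"
    by (simp add: opnorm_nonneg)
  fix v :: "real Matrix.vec" assume v: "v \<in> carrier_vec n"
  have "vnorm (A * B *\<^sub>v v) \<le> opnorm A * vnorm (B *\<^sub>v v)"
    using vnorm_mult_mat_vec_le[OF A, of "B *\<^sub>v v"] A B v by simp
  also have "\<dots> \<le> opnorm A * (opnorm B * vnorm v)"
    by (intro mult_left_mono vnorm_mult_mat_vec_le[OF B v] opnorm_nonneg)
  finally show "vnorm (A * B *\<^sub>v v) \<le> opnorm A * opnorm B * vnorm v"
    by (simp add: mult.assoc)
qed

lemma opnorm_smult_le:
  fixes A :: "real mat"
  assumes A: "A \<in> carrier_mat m n"
  shows "opnorm (c \<cdot>\<^sub>m A) \<le> \<bar>c\<bar> * opnorm A"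
proof (rule opnorm_le)
  show "c \<cdot>\<^sub>m A \<in> carrier_mat m n"
    using A by simp
  show "0 \<le> \<bar>c\<bar> * opnorm A"
    by (simp add: opnorm_nonneg)
  fix v :: "real Matrix.vec" assume v: "v \<in> carrier_vec n"
  have "c \<cdot>\<^sub>m A *\<^sub>v v = c \<cdot>\<^sub>v (A *\<^sub>v v)"
    using A v by (intro eq_vecI) auto
  then show "vnorm (c \<cdot>\<^sub>m A *\<^sub>v v) \<le> \<bar>c\<bar> * opnorm A * vnorm v"
    using vnorm_mult_mat_vec_le[OF A v] by (simp add: vnorm_smult mult.assoc mult_left_mono)
qed

lemma opnorm_smult:
  fixes A :: "real mat"
  assumes A: "A \<in> carrier_mat m n" and c: "c > 0"
  shows "opnorm (c \<cdot>\<^sub>m A) = c * opnorm A"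
proof (rule antisym)
  show "opnorm (c \<cdot>\<^sub>m A) \<le> c * opnorm A"
    using opnorm_smult_le[OF A, of c] c by simp
  \<comment> \<open>The reverse inequality is the first one for the factor \<open>1 / c\<close> and
    the matrix \<open>c \<cdot>\<^sub>m A\<close>.\<close>
  have "(1 / c) \<cdot>\<^sub>m (c \<cdot>\<^sub>m A) = A"
    using c by (intro eq_matI) auto
  then have "opnorm A \<le> 1 / c * opnorm (c \<cdot>\<^sub>m A)"
    using opnorm_smult_le[of "c \<cdot>\<^sub>m A" m n "1 / c"] A c by simp
  then show "c * opnorm A \<le> opnorm (c \<cdot>\<^sub>m A)"
    using c by (simp add: field_simps)
qed

section \<open>Diagonal matrices and inverses\<close>

lemma mat_diag_mult_vec:
  fixes v :: "real Matrix.vec"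
  assumes "v \<in> carrier_vec n"
  shows "mat_diag n h *\<^sub>v v = Matrix.vec n (\<lambda>i. h i * Matrix.vec_index v i)"
proof (rule eq_vecI)
  fix i assume "i < dim_vec (Matrix.vec n (\<lambda>i. h i * Matrix.vec_index v i))"
  then have i: "i < n"
    by simp
  have "Matrix.vec_index (mat_diag n h *\<^sub>v v) i
      = (\<Sum>j<n. (if i = j then h j else 0) * Matrix.vec_index v j)"
    using i assms by (simp add: mat_diag_def scalar_prod_def atLeast0LessThan)
  also have "\<dots> = (\<Sum>j<n. if i = j then h j * Matrix.vec_index v j else 0)"
    by (intro sum.cong) auto
  also have "\<dots> = h i * Matrix.vec_index v i"
    using i by simp
  finally show "Matrix.vec_index (mat_diag n h *\<^sub>v v) i
      = Matrix.vec_index (Matrix.vec n (\<lambda>i. h i * Matrix.vec_index v i)) i"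
    using i by simp
qed (simp add: mat_diag_def)

lemma scalar_prod_mat_diag:
  fixes v :: "real Matrix.vec"
  assumes "v \<in> carrier_vec n"
  shows "v \<bullet> (mat_diag n h *\<^sub>v v) = (\<Sum>i<n. h i * (Matrix.vec_index v i)\<^sup>2)"
  by (simp add: mat_diag_mult_vec[OF assms])
     (simp add: scalar_prod_def atLeast0LessThan power2_eq_square mult_ac)

lemma smult_one_mat_diag: "c \<cdot>\<^sub>m 1\<^sub>m n = mat_diag n (\<lambda>_. c :: real)"
  by (intro eq_matI) (auto simp: mat_diag_def)

lemma loewner_le_mat_diag:
  assumes "\<And>i. i < n \<Longrightarrow> h i \<le> k i"
  shows "loewner_le n (mat_diag n h) (mat_diag n k)"
  unfolding loewner_le_def using assms
  by (auto simp: scalar_prod_mat_diag intro!: sum_mono mult_right_mono)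

lemma opnorm_mat_diag_le:
  assumes h: "\<And>i. i < n \<Longrightarrow> \<bar>h i\<bar> \<le> K" and "0 \<le> K"
  shows "opnorm (mat_diag n h) \<le> K"
proof (rule opnorm_le[OF mat_diag_dim \<open>0 \<le> K\<close>])
  fix v :: "real Matrix.vec" assume v: "v \<in> carrier_vec n"
  have "(vnorm (mat_diag n h *\<^sub>v v))\<^sup>2 = (\<Sum>i<n. (h i)\<^sup>2 * (Matrix.vec_index v i)\<^sup>2)"
    by (simp add: vnorm_power2 mat_diag_mult_vec[OF v])
       (simp add: scalar_prod_def atLeast0LessThan power2_eq_square mult_ac)
  also have "\<dots> \<le> (\<Sum>i<n. K\<^sup>2 * (Matrix.vec_index v i)\<^sup>2)"
    using h \<open>0 \<le> K\<close> by (intro sum_mono mult_right_mono) (auto simp: abs_le_square_iff[symmetric])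
  also have "\<dots> = (K * vnorm v)\<^sup>2"
    using v by (simp only: power_mult_distrib vnorm_power2)
      (simp add: scalar_prod_def atLeast0LessThan sum_distrib_left power2_eq_square)
  finally show "vnorm (mat_diag n h *\<^sub>v v) \<le> K * vnorm v"
    by (rule power2_le_imp_le) (simp add: vnorm_nonneg \<open>0 \<le> K\<close>)
qed

text \<open>If \<open>mat_inverse A\<close> were \<open>None\<close>, \<open>A\<close> would not be
  a unit of the matrix ring, which \<open>B\<close> refutes. Otherwise it returns a right inverse
  \<open>C\<close>, and \<open>C = B * A * C = B\<close>.\<close>

lemma minv_eqI:
  fixes A B :: "real mat"
  assumes A: "A \<in> carrier_mat n n" and B: "B \<in> carrier_mat n n"
    and AB: "A * B = 1\<^sub>m n" and BA: "B * A = 1\<^sub>m n"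
  shows "minv A = B"
proof (cases "mat_inverse A")
  case None
  have "A \<in> Units (ring_mat TYPE(real) n ())"
    using A B AB BA by (auto simp: Units_def ring_mat_def)
  then show ?thesis
    using mat_inverse(1)[OF A None, where b = "()"] by blast
next
  case (Some C)
  then have C: "A * C = 1\<^sub>m n" "C \<in> carrier_mat n n"
    using mat_inverse(2)[OF A] by auto
  have "C = B * A * C"
    using C by (simp add: BA)
  also have "\<dots> = B"
    using A B C by simp
  finally show ?thesis
    by (simp add: minv_def Some)
qed

lemma minv_mat_diag:
  assumes "\<And>i. i < n \<Longrightarrow> h i \<noteq> 0"
  shows "minv (mat_diag n h) = mat_diag n (\<lambda>i. 1 / h i)"
proof (rule minv_eqI[of _ n])
  have "mat_diag n (\<lambda>i. h i * (1 / h i)) = mat_diag n (\<lambda>_. 1)"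
    "mat_diag n (\<lambda>i. 1 / h i * h i) = mat_diag n (\<lambda>_. 1)"
    using assms by (auto simp: mat_diag_def intro!: eq_matI)
  then show "mat_diag n h * mat_diag n (\<lambda>i. 1 / h i) = 1\<^sub>m n"
    "mat_diag n (\<lambda>i. 1 / h i) * mat_diag n h = 1\<^sub>m n"
    by (simp_all only: mat_diag_diag mat_diag_one)
qed simp_all

lemma minv_GL:
  assumes "L \<in> GL n"
  shows "minv L \<in> carrier_mat n n" "L * minv L = 1\<^sub>m n" "minv L * L = 1\<^sub>m n"
proof -
  have L: "L \<in> carrier_mat n n" and "invertible_mat L"
    using assms by (auto simp: GL_def)
  then obtain B where B: "L * B = 1\<^sub>m (dim_row L)" "B * L = 1\<^sub>m (dim_row B)"
    by (auto simp: invertible_mat_def inverts_mat_def)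
  \<comment> \<open>\<open>invertible_mat\<close> does not state the size of \<open>B\<close>.
    Counting the columns on both sides of the two identities determines it.\<close>
  have "dim_col B = n"
    using arg_cong[OF B(1), of dim_col] L by simp
  moreover have "dim_row B = n"
    using arg_cong[OF B(2), of dim_col] L by simp
  ultimately have "B \<in> carrier_mat n n"
    by auto
  moreover from this have "minv L = B"
    using L B by (intro minv_eqI[of _ n]) auto
  ultimately show "minv L \<in> carrier_mat n n" "L * minv L = 1\<^sub>m n" "minv L * L = 1\<^sub>m n"
    using L B by auto
qed

section \<open>Matrices that are not similarities\<close>

lemma scalar_prod_mult_mat_vec_unit:
  fixes L :: "real mat"
  assumes L: "L \<in> carrier_mat m n" and "i < n" "j < n"
  shows "(L *\<^sub>v unit_vec n i) \<bullet> (L *\<^sub>v unit_vec n j) = (L\<^sup>T * L) $$ (i, j)"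
proof -
  have "L *\<^sub>v unit_vec n k = col L k" if "k < n" for k
    using L that by (intro eq_vecI) auto
  then show ?thesis
    using assms by simp
qed

lemma scaled_isometry_imp_orthogonal:
  fixes L :: "real mat"
  assumes L: "L \<in> carrier_mat n n" and "0 \<le> a"
    and iso: "\<And>v. v \<in> carrier_vec n \<Longrightarrow> a * ((L *\<^sub>v v) \<bullet> (L *\<^sub>v v)) = v \<bullet> v"
  shows "sqrt a \<cdot>\<^sub>m L \<in> orthogonal_matrices n"
proof -
  \<comment> \<open>Polarization: the values of a quadratic form at \<open>v\<close>,
    \<open>w\<close> and \<open>v + w\<close> determine the associated bilinear form at
    \<open>v\<close> and \<open>w\<close>.\<close>
  have polar: "a * ((L *\<^sub>v v) \<bullet> (L *\<^sub>v w)) = v \<bullet> w"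
    if v: "v \<in> carrier_vec n" and w: "w \<in> carrier_vec n" for v w
  proof -
    have Lv: "L *\<^sub>v v \<in> carrier_vec n" and Lw: "L *\<^sub>v w \<in> carrier_vec n"
      using L v w by auto
    have expand: "(x + y) \<bullet> (x + y) = x \<bullet> x + 2 * (x \<bullet> y) + y \<bullet> y"
      if "x \<in> carrier_vec n" "y \<in> carrier_vec n" for x y :: "real Matrix.vec"
      using that comm_scalar_prod[of x n y]
      by (simp add: add_scalar_prod_distrib[of _ n] scalar_prod_add_distrib[of _ n])
    have "L *\<^sub>v (v + w) = L *\<^sub>v v + L *\<^sub>v w"
      using mult_add_distrib_mat_vec[OF L v w] .
    then show ?thesis
      using iso[of "v + w"] iso[OF v] iso[OF w] v w expand[OF v w] expand[OF Lv Lw]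
      by (simp add: algebra_simps)
  qed
  have "(sqrt a \<cdot>\<^sub>m L)\<^sup>T * (sqrt a \<cdot>\<^sub>m L) = 1\<^sub>m n"
  proof (rule eq_matI)
    fix i j assume "i < dim_row (1\<^sub>m n :: real mat)" "j < dim_col (1\<^sub>m n :: real mat)"
    then have ij: "i < n" "j < n"
      by auto
    have "((sqrt a \<cdot>\<^sub>m L)\<^sup>T * (sqrt a \<cdot>\<^sub>m L)) $$ (i, j) = a * (L\<^sup>T * L) $$ (i, j)"
    proof -
      have "col (sqrt a \<cdot>\<^sub>m L) k = sqrt a \<cdot>\<^sub>v col L k" if "k < n" for k
        using L that by (intro eq_vecI) auto
      then show ?thesis
        using L ij \<open>0 \<le> a\<close> by (simp flip: mult.assoc)
    qed
    also have "\<dots> = unit_vec n i \<bullet> unit_vec n j"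
      using polar[of "unit_vec n i" "unit_vec n j"] scalar_prod_mult_mat_vec_unit[OF L ij] by simp
    finally show "((sqrt a \<cdot>\<^sub>m L)\<^sup>T * (sqrt a \<cdot>\<^sub>m L)) $$ (i, j) = 1\<^sub>m n $$ (i, j)"
      using ij by simp
  qed (use L in auto)
  then show ?thesis
    using L by (simp add: orthogonal_matrices_def)
qed

text \<open>The left side equals \<open>v \<bullet> (A * A\<^sup>T *\<^sub>v v)\<close>, to which
  Cauchy-Schwarz and the operator norm bound apply.\<close>

lemma scalar_prod_mult_transpose_le:
  fixes A :: "real mat"
  assumes A: "A \<in> carrier_mat n n" and v: "v \<in> carrier_vec n"
  shows "(A\<^sup>T *\<^sub>v v) \<bullet> (A\<^sup>T *\<^sub>v v) \<le> opnorm (A * A\<^sup>T) * (v \<bullet> v)"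
proof -
  have "(A\<^sup>T *\<^sub>v v) \<bullet> (A\<^sup>T *\<^sub>v v) = v \<bullet> (A * A\<^sup>T *\<^sub>v v)"
    using A v transpose_vec_mult_scalar[OF A, of "A\<^sup>T *\<^sub>v v" v] by simp
  also have "\<dots> \<le> vnorm v * vnorm (A * A\<^sup>T *\<^sub>v v)"
    using A v by (intro scalar_prod_le_vnorm) auto
  also have "\<dots> \<le> vnorm v * (opnorm (A * A\<^sup>T) * vnorm v)"
    using A v by (intro mult_left_mono vnorm_mult_mat_vec_le vnorm_nonneg) auto
  finally show ?thesis
    by (simp add: vnorm_power2[symmetric] power2_eq_square mult_ac)
qed

text \<open>The constant is the one for the transpose, although \<open>A\<close> itself now acts.
  With \<open>w = A *\<^sub>v v\<close>, Cauchy-Schwarz gives |w|^2 = (A^T w) . v \<le> |A^T w| |v|;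
  squaring and the preceding lemma at \<open>w\<close> give |w|^4 \<le> b |w|^2 |v|^2, and a factor
  |w|^2 cancels.\<close>

lemma scalar_prod_mult_le:
  fixes A :: "real mat"
  assumes A: "A \<in> carrier_mat n n" and v: "v \<in> carrier_vec n"
  shows "(A *\<^sub>v v) \<bullet> (A *\<^sub>v v) \<le> opnorm (A * A\<^sup>T) * (v \<bullet> v)"
proof -
  let ?w = "A *\<^sub>v v" and ?b = "opnorm (A * A\<^sup>T)"
  have w: "?w \<in> carrier_vec n"
    using A v by auto
  have "(vnorm ?w)\<^sup>2 = (A\<^sup>T *\<^sub>v ?w) \<bullet> v"
    using transpose_vec_mult_scalar[OF A v w] by (simp add: vnorm_power2)
  also have "\<dots> \<le> vnorm (A\<^sup>T *\<^sub>v ?w) * vnorm v"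
    using A v by (intro scalar_prod_le_vnorm) auto
  finally have "((vnorm ?w)\<^sup>2)\<^sup>2 \<le> (vnorm (A\<^sup>T *\<^sub>v ?w) * vnorm v)\<^sup>2"
    by (intro power_mono) auto
  also have "\<dots> = (vnorm (A\<^sup>T *\<^sub>v ?w))\<^sup>2 * (vnorm v)\<^sup>2"
    by (simp add: power_mult_distrib)
  also have "\<dots> \<le> ?b * (vnorm ?w)\<^sup>2 * (vnorm v)\<^sup>2"
    using scalar_prod_mult_transpose_le[OF A w] by (intro mult_right_mono) (simp_all add: vnorm_power2 scalar_prod_self_nonneg)
  finally have *: "(vnorm ?w)\<^sup>2 * (vnorm ?w)\<^sup>2 \<le> (vnorm ?w)\<^sup>2 * (?b * (vnorm v)\<^sup>2)"
    by (simp add: power2_eq_square mult_ac)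
  have "(vnorm ?w)\<^sup>2 \<le> ?b * (vnorm v)\<^sup>2"
  proof (cases "vnorm ?w = 0")
    case True
    then show ?thesis
      by (simp add: opnorm_nonneg)
  next
    case False
    then have "(vnorm ?w)\<^sup>2 > 0"
      by simp
    with * show ?thesis
      by (simp only: mult_le_cancel_left_pos)
  qed
  then show ?thesis
    by (simp add: vnorm_power2)
qed

lemma one_less_opnorm_prod:
  assumes L: "L \<in> GL n" and nonorth: "\<And>c. c \<cdot>\<^sub>m L \<notin> orthogonal_matrices n"
  shows "1 < opnorm ((minv L)\<^sup>T * minv L) * opnorm (L * L\<^sup>T)"
proof (rule ccontr)
  let ?a = "opnorm ((minv L)\<^sup>T * minv L)" and ?b = "opnorm (L * L\<^sup>T)"
  assume "\<not> 1 < ?a * ?b"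
  then have ab: "?a * ?b \<le> 1"
    by simp
  have carr: "L \<in> carrier_mat n n" "minv L \<in> carrier_mat n n"
    using L minv_GL[OF L] by (auto simp: GL_def)
  have "?a * ((L *\<^sub>v v) \<bullet> (L *\<^sub>v v)) = v \<bullet> v" if v: "v \<in> carrier_vec n" for v
  proof (rule antisym)
    have "?a * ((L *\<^sub>v v) \<bullet> (L *\<^sub>v v)) \<le> ?a * (?b * (v \<bullet> v))"
      using carr v by (intro mult_left_mono scalar_prod_mult_le opnorm_nonneg)
    also have "\<dots> \<le> v \<bullet> v"
      using mult_right_mono[OF ab scalar_prod_self_nonneg[of v]] by (simp add: mult.assoc)
    finally show "?a * ((L *\<^sub>v v) \<bullet> (L *\<^sub>v v)) \<le> v \<bullet> v" .
    \<comment> \<open>The transpose bound is used for the matrix \<open>(minv L)\<^sup>T\<close> at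
      the vector \<open>L *\<^sub>v v\<close>, which its transpose \<open>minv L\<close> sends back
      to \<open>v\<close>.\<close>
    have "minv L *\<^sub>v (L *\<^sub>v v) = v"
      using assoc_mult_mat_vec[OF carr(2,1) v] v by (simp add: minv_GL[OF L])
    then show "v \<bullet> v \<le> ?a * ((L *\<^sub>v v) \<bullet> (L *\<^sub>v v))"
      using scalar_prod_mult_transpose_le[of "(minv L)\<^sup>T" n "L *\<^sub>v v"] carr v by simp
  qed
  then show False
    using scaled_isometry_imp_orthogonal[OF carr(1) opnorm_nonneg] nonorth by blast
qed

section \<open>A separable potential\<close>

text \<open>The square supplies convexity and integrability, the cosine makes the curvature vary.
  All summands have the same form, so at a point with equal coordinates the Hessian is a multiple of
  the identity.\<close>

definition sep_potential :: "nat \<Rightarrow> (nat \<Rightarrow> real) \<Rightarrow> real" where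
  "sep_potential d x = (\<Sum>i<d. (x i)\<^sup>2 - cos (x i))"

lemma sep_potential_upd_has_derivative:
  assumes "i < d"
  shows "((\<lambda>t. sep_potential d (x(i := t))) has_field_derivative 2 * s + sin s) (at s)"
proof -
  \<comment> \<open>Only the \<open>i\<close>-th summand depends on \<open>t\<close>; the others
    form a constant.\<close>
  have "sep_potential d (x(i := t)) = (t\<^sup>2 - cos t) + (\<Sum>k\<in>{..<d} - {i}. (x k)\<^sup>2 - cos (x k))" for t
    using assms by (simp add: sep_potential_def sum.remove[of _ i])
  then have "(\<lambda>t. sep_potential d (x(i := t)))
      = (\<lambda>t. (t\<^sup>2 - cos t) + (\<Sum>k\<in>{..<d} - {i}. (x k)\<^sup>2 - cos (x k)))"
    by blast
  then show ?thesis
    by (auto intro!: derivative_eq_intros)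
qed

text \<open>An equation between functions, valid also outside \<open>Rn d\<close>, so it can be
  rewritten inside a further \<open>partial\<close>.\<close>

lemma partial_sep_potential:
  "i < d \<Longrightarrow> partial i (sep_potential d) = (\<lambda>x. 2 * x i + sin (x i))"
  unfolding partial_def using DERIV_imp_deriv[OF sep_potential_upd_has_derivative] by blast

lemma partial_sep_potential_upd_has_derivative:
  fixes x :: "nat \<Rightarrow> real"
  shows "((\<lambda>t. 2 * (x(j := t)) i + sin ((x(j := t)) i)) has_field_derivative
     (if i = j then 2 + cos s else (0::real))) (at s)"
  by (auto intro!: derivative_eq_intros)

lemma partial_partial_sep_potential:
  assumes "i < d"
  shows "partial j (partial i (sep_potential d)) = (\<lambda>x. if i = j then 2 + cos (x j) else 0)"
  unfolding partial_sep_potential[OF assms] partial_def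
  by (rule ext) (rule DERIV_imp_deriv[OF partial_sep_potential_upd_has_derivative])

lemma C2_sep_potential: "C2 d (sep_potential d)"
proof -
  have "continuous_on (Rn d) (sep_potential d)"
    unfolding sep_potential_def
    by (intro continuous_intros continuous_on_subset[OF continuous_on_product_coordinates]) auto
  moreover have "has_partials d (sep_potential d)"
    unfolding has_partials_def field_differentiable_def
    using sep_potential_upd_has_derivative by blast
  moreover have "continuous_on (Rn d) (partial i (sep_potential d))" if "i < d" for i
    unfolding partial_sep_potential[OF that]
    by (intro continuous_intros continuous_on_subset[OF continuous_on_product_coordinates]) auto
  moreover have "has_partials d (partial i (sep_potential d))" if "i < d" for i
    unfolding has_partials_def field_differentiable_def partial_sep_potential[OF that]
    using partial_sep_potential_upd_has_derivative by blast
  moreover have "continuous_on (Rn d) (partial j (partial i (sep_potential d)))" if "i < d" for i j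
    unfolding partial_partial_sep_potential[OF that]
    by (cases "i = j")
       (auto intro!: continuous_intros continuous_on_subset[OF continuous_on_product_coordinates])
  ultimately show ?thesis
    by (simp add: C2_def)
qed

lemma hessian_sep_potential:
  "hessian d (sep_potential d) x = mat_diag d (\<lambda>i. 2 + cos (x i))"
  by (intro eq_matI) (auto simp: hessian_def mat_diag_def partial_partial_sep_potential)

lemma two_plus_cos_bounds: "1 \<le> 2 + cos (t :: real)" "2 + cos t \<le> 3" "2 + cos t \<noteq> 0"
  using cos_ge_minus_one[of t] cos_le_one[of t] by linarith+

lemma minv_hessian_sep_potential:
  "minv (hessian d (sep_potential d) x) = mat_diag d (\<lambda>i. 1 / (2 + cos (x i)))"
  by (simp add: hessian_sep_potential minv_mat_diag two_plus_cos_bounds)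

lemma opnorm_hessian_sep_potential_le: "opnorm (hessian d (sep_potential d) x) \<le> 3"
  unfolding hessian_sep_potential
proof (rule opnorm_mat_diag_le)
  show "\<bar>2 + cos (x i)\<bar> \<le> 3" for i
    using two_plus_cos_bounds(1,2)[of "x i"] by linarith
qed simp

lemma opnorm_minv_hessian_sep_potential_le: "opnorm (minv (hessian d (sep_potential d) x)) \<le> 1"
  unfolding minv_hessian_sep_potential
proof (rule opnorm_mat_diag_le)
  show "\<bar>1 / (2 + cos (x i))\<bar> \<le> 1" for i
    using two_plus_cos_bounds(1)[of "x i"] by simp
qed simp

section \<open>Normalising the density\<close>

definition sep_measure :: "nat \<Rightarrow> real \<Rightarrow> (nat \<Rightarrow> real) measure" where
  "sep_measure d c = density (lborel_Rn d) (\<lambda>x. ennreal (c * exp (- sep_potential d x)))"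

text \<open>Finite by comparison with a Gaussian, positive because the integrand is positive
  everywhere. Both facts are needed to divide by the normalising integral.\<close>

lemma nn_integral_exp_sep_factor:
  "(\<integral>\<^sup>+t. ennreal (exp (- (t\<^sup>2 - cos t))) \<partial>lborel) < \<infinity>"
  "0 < (\<integral>\<^sup>+t. ennreal (exp (- (t\<^sup>2 - cos t))) \<partial>lborel)"
proof -
  let ?f = "\<lambda>t :: real. exp (- (t\<^sup>2 - cos t))"
  have bound: "?f t \<le> exp 1 * sqrt (2 * pi) * std_normal_density t" for t
  proof -
    \<comment> \<open>Half of the quadratic decay is given up so that the majorant is a multiple of
      the standard normal density.\<close>
    have "- (t\<^sup>2 - cos t) \<le> 1 + - t\<^sup>2 / 2"
      using cos_le_one[of t] zero_le_power2[of t] by linarith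
    then have "?f t \<le> exp (1 + - t\<^sup>2 / 2)"
      by (simp only: exp_le_cancel_iff)
    also have "\<dots> = exp 1 * sqrt (2 * pi) * std_normal_density t"
      by (simp only: exp_add) (simp add: std_normal_density_def)
    finally show ?thesis .
  qed
  have "integrable lborel ?f"
  proof (rule Bochner_Integration.integrable_bound)
    show "integrable lborel (\<lambda>t. exp 1 * sqrt (2 * pi) * std_normal_density t)"
      by (intro integrable_mult_right integrable_normal_density) simp
    show "AE t in lborel. norm (?f t) \<le> norm (exp 1 * sqrt (2 * pi) * std_normal_density t)"
      using bound by (intro AE_I2) (simp only: real_norm_def abs_exp_cancel, rule order.trans[OF _ abs_ge_self])
  qed measurable
  then show "(\<integral>\<^sup>+t. ennreal (?f t) \<partial>lborel) < \<infinity>"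
    by (simp add: integrable_iff_bounded)
  \<comment> \<open>A zero integral would make a positive function vanish almost everywhere, but
    \<open>lborel\<close> is not the null measure.\<close>
  have "(\<integral>\<^sup>+t. ennreal (?f t) \<partial>lborel) \<noteq> 0"
    by (subst nn_integral_0_iff_AE) (auto simp: eventually_False ae_filter_eq_bot_iff)
  then show "0 < (\<integral>\<^sup>+t. ennreal (?f t) \<partial>lborel)"
    by (simp add: zero_less_iff_neq_zero)
qed

text \<open>The exponential turns the sum into a product, so the total mass \<open>Z\<close> factors
  into one-dimensional integrals, each positive and finite; \<open>c\<close> is the reciprocal of
  \<open>Z\<close>.\<close>

lemma prob_space_sep_measure: "\<exists>c>0. prob_space (sep_measure d c)"
proof -
  interpret product_sigma_finite "\<lambda>_ :: nat. lborel :: real measure" ..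
  define Z where "Z = (\<integral>\<^sup>+x. ennreal (exp (- sep_potential d x)) \<partial>lborel_Rn d)"
  have "ennreal (exp (- sep_potential d x)) = (\<Prod>i<d. ennreal (exp (- ((x i)\<^sup>2 - cos (x i)))))" for x
    by (simp add: sep_potential_def exp_sum prod_ennreal flip: sum_negf)
  then have "Z = (\<Prod>i<d. \<integral>\<^sup>+t. ennreal (exp (- (t\<^sup>2 - cos t))) \<partial>lborel)"
    unfolding Z_def lborel_Rn_def by (simp only:) (rule product_nn_integral_prod; measurable)
  then have "Z \<noteq> 0" "Z \<noteq> \<infinity>"
    using nn_integral_exp_sep_factor by (auto simp: power_eq_top_ennreal_iff)
  then obtain z where z: "Z = ennreal z" "z > 0"
    by (cases Z) (auto simp: ennreal_eq_0_iff not_le)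
  have meas: "(\<lambda>x. ennreal (exp (- sep_potential d x))) \<in> borel_measurable (lborel_Rn d)"
    unfolding sep_potential_def lborel_Rn_def by measurable
  have dens: "ennreal (1 / z * exp (- sep_potential d x))
      = ennreal (1 / z) * ennreal (exp (- sep_potential d x))" for x
    using z(2) by (intro ennreal_mult) auto
  have "emeasure (sep_measure d (1 / z)) (space (sep_measure d (1 / z)))
      = (\<integral>\<^sup>+x. ennreal (1 / z) * ennreal (exp (- sep_potential d x)) \<partial>lborel_Rn d)"
    unfolding sep_measure_def dens using meas
    by (simp add: emeasure_density cong: nn_integral_cong)
  also have "\<dots> = ennreal (1 / z) * Z"
    unfolding Z_def using meas by (rule nn_integral_cmult)
  also have "\<dots> = 1"
    using z by (simp flip: ennreal_mult')
  finally show ?thesis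
    using z(2) by (intro exI[of _ "1 / z"]) (auto intro: prob_spaceI)
qed

lemma well_conditioned_sep_potential: "\<exists>\<mu>. well_conditioned d \<mu> (sep_potential d)"
proof -
  obtain c where c: "c > 0" "prob_space (sep_measure d c)"
    using prob_space_sep_measure by blast
  have "loewner_le d (1 \<cdot>\<^sub>m 1\<^sub>m d) (hessian d (sep_potential d) x)"
    "loewner_le d (hessian d (sep_potential d) x) (3 \<cdot>\<^sub>m 1\<^sub>m d)" for x
    unfolding smult_one_mat_diag hessian_sep_potential
    by (intro loewner_le_mat_diag two_plus_cos_bounds)+
  then have "\<exists>m M. 0 < m \<and> m \<le> M \<and>
        (\<forall>x\<in>Rn d. loewner_le d (m \<cdot>\<^sub>m 1\<^sub>m d) (hessian d (sep_potential d) x) \<and>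
                   loewner_le d (hessian d (sep_potential d) x) (M \<cdot>\<^sub>m 1\<^sub>m d))"
    by (intro exI[of _ 1] exI[of _ 3]) simp
  then show ?thesis
    using c C2_sep_potential unfolding well_conditioned_def sep_measure_def by blast
qed

section \<open>The condition number before and after preconditioning\<close>

lemma Rn_const: "(\<lambda>i\<in>{..<d}. t) \<in> Rn d"
  by (simp add: Rn_def)

text \<open>The pointwise bounds 3 and 1 on the Hessian and its inverse pass to the suprema. The
  second supremum must also be known to be nonnegative before the two bounds can be
  multiplied.\<close>

lemma cond_number_sep_potential_le: "cond_number d (sep_potential d) \<le> 3"
proof -
  have ne: "Rn d \<noteq> {}"
    using Rn_const by blast
  have "(SUP x\<in>Rn d. opnorm (hessian d (sep_potential d) x)) \<le> 3"
    "(SUP x\<in>Rn d. opnorm (minv (hessian d (sep_potential d) x))) \<le> 1"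
    using ne by (auto intro!: cSUP_least opnorm_hessian_sep_potential_le
        opnorm_minv_hessian_sep_potential_le)
  moreover have "0 \<le> (SUP x\<in>Rn d. opnorm (minv (hessian d (sep_potential d) x)))"
    by (rule cSUP_upper2[OF _ Rn_const[of 0 d]];
        intro bdd_aboveI2[where M = 1] opnorm_minv_hessian_sep_potential_le opnorm_nonneg)
  ultimately have "cond_number d (sep_potential d) \<le> 3 * 1"
    unfolding cond_number_def by (intro mult_mono) auto
  then show ?thesis
    by simp
qed

text \<open>With \<open>K\<close> independent of the point, this bounds the sets whose suprema
  define \<open>precond_cond_number\<close>; only then do values at single points bound those
  suprema from below.\<close>

lemma opnorm_conj_le:
  fixes A B H :: "real mat"
  assumes "A \<in> carrier_mat n n" "H \<in> carrier_mat n n" "B \<in> carrier_mat n n" "opnorm H \<le> K"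
  shows "opnorm (A * H * B) \<le> opnorm A * K * opnorm B"
proof -
  have "opnorm (A * H * B) \<le> opnorm (A * H) * opnorm B"
    using assms by (intro opnorm_mult_le) auto
  also have "\<dots> \<le> opnorm A * opnorm H * opnorm B"
    using assms by (intro mult_right_mono opnorm_mult_le opnorm_nonneg) auto
  also have "\<dots> \<le> opnorm A * K * opnorm B"
    using assms by (intro mult_right_mono mult_left_mono opnorm_nonneg) auto
  finally show ?thesis .
qed

lemma precond_cond_number_sep_potential_ge:
  assumes L: "L \<in> GL d"
  shows "3 * (opnorm ((minv L)\<^sup>T * minv L) * opnorm (L * L\<^sup>T))
    \<le> precond_cond_number d L (sep_potential d)"
proof -
  let ?H = "hessian d (sep_potential d)"
  have carr: "L \<in> carrier_mat d d" "minv L \<in> carrier_mat d d"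
    using L minv_GL[OF L] by (auto simp: GL_def)
  have H: "?H x \<in> carrier_mat d d" "minv (?H x) \<in> carrier_mat d d" for x
    unfolding minv_hessian_sep_potential unfolding hessian_sep_potential by simp_all
  \<comment> \<open>The curvature is largest where every cosine is 1. The Hessian is scalar there
    and commutes past \<open>L\<close>, leaving \<open>(minv L)\<^sup>T * minv L\<close>.\<close>
  have "?H (\<lambda>i\<in>{..<d}. 0) = 3 \<cdot>\<^sub>m 1\<^sub>m d"
    unfolding hessian_sep_potential by (intro eq_matI) (auto simp: mat_diag_def)
  then have "(minv L)\<^sup>T * ?H (\<lambda>i\<in>{..<d}. 0) * minv L = 3 \<cdot>\<^sub>m ((minv L)\<^sup>T * minv L)"
    using carr by (simp add: mult_smult_distrib[of _ d d _ d] mult_smult_assoc_mat[of _ d d _ d])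
  then have "3 * opnorm ((minv L)\<^sup>T * minv L) = opnorm ((minv L)\<^sup>T * ?H (\<lambda>i\<in>{..<d}. 0) * minv L)"
    using carr by (simp add: opnorm_smult[of _ d d])
  also have "\<dots> \<le> (SUP x\<in>Rn d. opnorm ((minv L)\<^sup>T * ?H x * minv L))"
    using carr H opnorm_hessian_sep_potential_le
    by (intro cSUP_upper Rn_const bdd_aboveI2[where M = "opnorm ((minv L)\<^sup>T) * 3 * opnorm (minv L)"]
        opnorm_conj_le[of _ d]) auto
  finally have 1: "3 * opnorm ((minv L)\<^sup>T * minv L) \<le> (SUP x\<in>Rn d. opnorm ((minv L)\<^sup>T * ?H x * minv L))" .
  \<comment> \<open>The second supremum is tested at a different point, where every cosine is -1 and
    the inverse Hessian is largest.\<close>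
  have "minv (?H (\<lambda>i\<in>{..<d}. pi)) = 1\<^sub>m d"
    unfolding minv_hessian_sep_potential by (intro eq_matI) (auto simp: mat_diag_def)
  then have "opnorm (L * L\<^sup>T) = opnorm (L * minv (?H (\<lambda>i\<in>{..<d}. pi)) * L\<^sup>T)"
    using carr by simp
  also have "\<dots> \<le> (SUP x\<in>Rn d. opnorm (L * minv (?H x) * L\<^sup>T))"
    using carr H opnorm_minv_hessian_sep_potential_le
    by (intro cSUP_upper Rn_const bdd_aboveI2[where M = "opnorm L * 1 * opnorm (L\<^sup>T)"]
        opnorm_conj_le[of _ d]) auto
  finally have 2: "opnorm (L * L\<^sup>T) \<le> (SUP x\<in>Rn d. opnorm (L * minv (?H x) * L\<^sup>T))" .
  have "0 \<le> (SUP x\<in>Rn d. opnorm ((minv L)\<^sup>T * ?H x * minv L))"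
    using 1 opnorm_nonneg[of "(minv L)\<^sup>T * minv L"] by linarith
  from mult_mono[OF 1 2 this opnorm_nonneg] show ?thesis
    by (simp add: precond_cond_number_def mult.assoc)
qed

theorem proposition1:
  "\<exists>(d::nat) (\<mu> :: (nat \<Rightarrow> real) measure) (U :: (nat \<Rightarrow> real) \<Rightarrow> real).
     2 \<le> d \<and> well_conditioned d \<mu> U \<and>
     (\<forall>L\<in>GL d. (\<forall>c::real. c \<cdot>\<^sub>m L \<notin> orthogonal_matrices d) \<longrightarrow>
        cond_number d U < precond_cond_number d L U)"
proof -
  \<comment> \<open>The lemmas hold for every \<open>d\<close>; the smallest admissible dimension is
    chosen. The conclusion is the chain \<kappa> \<le> 3 < 3 a b \<le> \<kappa>'.\<close>
  obtain \<mu> where "well_conditioned 2 \<mu> (sep_potential 2)"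
    using well_conditioned_sep_potential by blast
  moreover have "cond_number 2 (sep_potential 2) < precond_cond_number 2 L (sep_potential 2)"
    if "L \<in> GL 2" "\<And>c. c \<cdot>\<^sub>m L \<notin> orthogonal_matrices 2" for L
    using cond_number_sep_potential_le[of 2] one_less_opnorm_prod[OF that]
      precond_cond_number_sep_potential_ge[OF that(1)] by linarith
  ultimately show ?thesis
    by blast
qed

end
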